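(* Let $A$ and $B$ be finite non-collinear sets in $\mathbb{R}^2$ such that every point of $A+B$ has a unique representation, i.e. whenever $a_1+b_1=a_2+b_2$ with $a_1,a_2\in A$, $b_1,b_2\in B$, then $a_1=a_2$ and $b_1=b_2$. Then $$\sqrt{2i_{A+B}+b_{A+B}-2}\geq \sqrt{2i_A+b_A-2}+\sqrt{2i_B+b_B-2},$$ equivalently $\mathrm{tr}(A+B)^{1/2}\geq \mathrm{tr}(A)^{1/2}+\mathrm{tr}(B)^{1/2}$.
   Context: $A+B=\{a+b:a\in A,\ b\in B\}$; $[X]$ is the convex hull of $X$. For a finite non-collinear set $C\subset\mathbb{R}^2$, $b_C$ and $i_C$ denote the number of points of $C$ on the boundary $\partial[C]$ and in the interior of $[C]$, respectively, and $\mathrm{tr}(C)$ denotes the common number of triangles in any triangulation of $[C]$ using the points of $C$ as vertices; one has $\mathrm{tr}(C)=b_C+2i_C-2$. *)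

theory Defs
  imports "HOL-Analysis.Analysis"
begin

definition boundary_count :: "(real^2) set \<Rightarrow> nat" where
  "boundary_count C = card (C \<inter> frontier (convex hull C))"

definition interior_count :: "(real^2) set \<Rightarrow> nat" where
  "interior_count C = card (C \<inter> interior (convex hull C))"

text \<open>
  The members of \<open>\<T>\<close> are the (closed, non-degenerate) triangles. The library's \<^const>\<open>triangulation\<close>
  makes them meet face to face. The vertex set is all of \<open>C\<close>, not merely a subset of it: only then
  does the number of triangles not depend on \<open>\<T>\<close>.
\<close>
definition triangulates :: "(real^2) set set \<Rightarrow> (real^2) set \<Rightarrow> bool" where
  "triangulates \<T> C \<longleftrightarrow>
     triangulation \<T> \<and> (\<forall>T\<in>\<T>. 2 simplex T) \<and>
     \<Union>\<T> = convex hull C \<and>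
     {v. \<exists>T\<in>\<T>. v extreme_point_of T} = C"

end

theory Submission
  imports Defs
begin

text \<open>
  If \<open>a + b\<close> lies on the boundary of \<open>[A + B]\<close>, then \<open>a\<close> and \<open>b\<close> lie on the boundaries of \<open>[A]\<close> and
  \<open>[B]\<close>, so the boundary counts are submultiplicative, while the cardinalities multiply by the
  unique representation. These two facts already give
  \<open>tr(A + B) \<ge> 2 (tr A + tr B) \<ge> (tr(A)^(1/2) + tr(B)^(1/2))^2\<close>.

  The formula \<open>tr C = b + 2 i - 2\<close> is obtained by counting triangles by their middle vertex with
  respect to a linear functional that is injective on \<open>C\<close>. A triangle with middle vertex \<open>v\<close> is the
  one entered by one of the two rays from \<open>v\<close> along the level line of \<open>v\<close>. Both rays enter \<open>[C]\<close>
  if \<open>v\<close> is an interior point, exactly one does if \<open>v\<close> is a boundary point, and none does at the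
  minimum and the maximum of the functional.
\<close>

section \<open>Linear functionals on the plane and their level lines\<close>

text \<open>The coefficient of the first coordinate is fixed at 1. The one remaining parameter is
  enough to make the functional injective on a finite set, because two points with different second
  coordinates share a level for exactly one \<open>s\<close>.\<close>

definition level :: "real \<Rightarrow> real^2 \<Rightarrow> real" where
  "level s x = x $ 1 + s * x $ 2"

text \<open>Spans the kernel of \<open>level s\<close>. Its second coordinate is 1, so a
  displacement along a level line can be read off the second coordinates.\<close>

definition level_dir :: "real \<Rightarrow> real^2" where
  "level_dir s = vector [- s, 1]"

lemma level_simps [simp]:
  "level s (x + y) = level s x + level s y"
  "level s (x - y) = level s x - level s y"
  "level s (c *\<^sub>R x) = c * level s x"
  "level s (level_dir s) = 0"
  by (auto simp: level_def level_dir_def algebra_simps)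

lemma level_dir_nonzero [simp]: "level_dir s \<noteq> 0"
  by (auto simp: level_dir_def vec_eq_iff forall_2)

lemma level_eq_inner: "level s x = vector [1, s] \<bullet> x"
  by (simp add: level_def inner_vec_def sum_2)

lemma convex_level_greater: "convex {x. level s x > c}"
  using convex_halfspace_gt[of c "vector [1, s]"] by (simp add: level_eq_inner)

lemma level_eqD:
  assumes "level s x = level s v"
  shows "x = v + (x $ 2 - v $ 2) *\<^sub>R level_dir s"
  using assms by (auto simp: level_def level_dir_def vec_eq_iff forall_2 algebra_simps)

lemma exists_injective_level:
  fixes C :: "(real^2) set"
  assumes "finite C"
  obtains s where "inj_on (level s) C"
proof -
  \<comment> \<open>Pairs with equal second coordinates contribute the value 0 of a division by
    zero, which merely excludes one more \<open>s\<close>.\<close>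
  let ?bad = "(\<lambda>(x, y). - (x $ 1 - y $ 1) / (x $ 2 - y $ 2)) ` (C \<times> C)"
  have "finite ?bad" using assms by simp
  then obtain s where s: "s \<notin> ?bad"
    using ex_new_if_finite infinite_UNIV_char_0 by blast
  have "inj_on (level s) C"
  proof (rule inj_onI)
    fix x y assume xy: "x \<in> C" "y \<in> C" "level s x = level s y"
    have "x $ 2 = y $ 2"
    proof (rule ccontr)
      assume n: "x $ 2 \<noteq> y $ 2"
      have "s * (x $ 2 - y $ 2) = - (x $ 1 - y $ 1)"
        using xy(3) by (simp add: level_def algebra_simps)
      then have "s = - (x $ 1 - y $ 1) / (x $ 2 - y $ 2)"
        using n by (simp add: field_simps)
      with s xy show False by force
    qed
    with xy(3) show "x = y" by (auto simp: level_def vec_eq_iff forall_2)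
  qed
  with that show ?thesis .
qed

lemma level_crossing:
  assumes "level s a < r" "r < level s c"
  obtains p where "p \<in> open_segment a c" "level s p = r"
proof -
  define t where "t = (r - level s a) / (level s c - level s a)"
  have t: "0 < t" "t < 1" "t * (level s c - level s a) = r - level s a"
    using assms by (auto simp: t_def field_simps)
  define p where "p = (1 - t) *\<^sub>R a + t *\<^sub>R c"
  have "a \<noteq> c" using assms by auto
  then have "p \<in> open_segment a c" using t by (auto simp: p_def in_segment)
  moreover have "level s p = r" using t(3) by (simp add: p_def algebra_simps)
  ultimately show ?thesis using that by blast
qed

text \<open>A point of the hull is a convex combination of \<open>v\<close> and a point of the hull
  of the rest, which lies strictly above the level of \<open>v\<close>. At the level of
  \<open>v\<close> the weight of the rest must vanish.\<close>

lemma hull_level_min_unique: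
  assumes "v \<in> C" "\<And>c. c \<in> C \<Longrightarrow> c \<noteq> v \<Longrightarrow> level s v < level s c"
    and "x \<in> convex hull C" "level s x = level s v"
  shows "x = v"
proof (cases "C - {v} = {}")
  case True
  then have "C = {v}" using assms(1) by auto
  then show ?thesis using assms(3) by simp
next
  case False
  have "C = insert v (C - {v})" using assms(1) by auto
  then have "x \<in> convex hull (insert v (C - {v}))" using assms(3) by simp
  then obtain a b y where *: "0 \<le> a" "0 \<le> b" "a + b = 1" "y \<in> convex hull (C - {v})"
    "x = a *\<^sub>R v + b *\<^sub>R y"
    unfolding convex_hull_insert[OF False] by auto
  have "convex hull (C - {v}) \<subseteq> {x. level s x > level s v}"
    using assms(2) by (intro hull_minimal convex_level_greater) auto
  then have y: "level s y > level s v" using * by auto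
  have a: "a = 1 - b" using * by simp
  have "b * (level s y - level s v) = 0"
    using assms(4) unfolding *(5) a by (simp add: algebra_simps)
  then have "b = 0" using y by simp
  then show ?thesis using * by simp
qed

text \<open>Reflection in the origin turns the maximum into a minimum.\<close>

lemma hull_level_max_unique:
  assumes "v \<in> C" "\<And>c. c \<in> C \<Longrightarrow> c \<noteq> v \<Longrightarrow> level s c < level s v"
    and "x \<in> convex hull C" "level s x = level s v"
  shows "x = v"
proof -
  have neg: "level s (- y) = - level s y" for y by (simp add: level_def)
  have "convex hull (uminus ` C) = uminus ` (convex hull C)"
    by (simp add: convex_hull_linear_image linear_uminus)
  then have "- x = - v"
    using assms by (intro hull_level_min_unique[of "- v" "uminus ` C" s]) (auto simp: neg)
  then show ?thesis by simp
qed

section \<open>Rays along level lines entering a set\<close>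

text \<open>One point of the ray is enough: if \<open>T\<close> is convex and contains
  \<open>v\<close>, the ray then stays in \<open>T\<close> up to that point. The sign
  \<open>\<sigma>\<close> selects one of the two rays.\<close>

definition enters :: "real \<Rightarrow> (real^2) set \<Rightarrow> real^2 \<Rightarrow> real \<Rightarrow> bool" where
  "enters s T v \<sigma> \<longleftrightarrow> (\<exists>\<epsilon>>0. v + (\<epsilon> * \<sigma>) *\<^sub>R level_dir s \<in> T)"

lemma enters_cases:
  assumes "x \<in> T" "level s x = level s v" "x \<noteq> v"
  obtains \<sigma> where "\<sigma> \<in> {1, -1}" "enters s T v \<sigma>"
proof -
  define t where "t = x $ 2 - v $ 2"
  have x: "x = v + t *\<^sub>R level_dir s" using level_eqD[OF assms(2)] by (simp add: t_def)
  then have "t \<noteq> 0" using assms(3) by auto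
  then have "enters s T v (sgn t)"
    unfolding enters_def using x assms(1) by (intro exI[of _ "\<bar>t\<bar>"]) (auto simp: abs_mult_sgn)
  moreover have "sgn t \<in> {1, -1}" using \<open>t \<noteq> 0\<close> by (auto simp: sgn_if)
  ultimately show ?thesis using that by blast
qed

text \<open>Otherwise \<open>v\<close> would lie strictly between two points of
  \<open>T\<close>.\<close>

lemma extreme_point_not_enters_both:
  assumes "v extreme_point_of T" "enters s T v 1" "enters s T v (-1)"
  shows False
proof -
  obtain d e where de: "d > 0" "e > 0" "v + d *\<^sub>R level_dir s \<in> T" "v - e *\<^sub>R level_dir s \<in> T"
    using assms(2,3) unfolding enters_def by auto
  let ?p = "v + d *\<^sub>R level_dir s" and ?q = "v - e *\<^sub>R level_dir s"
  \<comment> \<open>The weight \<open>d / (d + e)\<close> balances the displacements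
    \<open>d\<close> and \<open>- e\<close>.\<close>
  have "v = (1 - d / (d + e)) *\<^sub>R ?p + (d / (d + e)) *\<^sub>R ?q"
  proof -
    have "(1 - d / (d + e)) * d - (d / (d + e)) * e = 0" using de by (simp add: field_simps)
    moreover have "(1 - d / (d + e)) *\<^sub>R ?p + (d / (d + e)) *\<^sub>R ?q
      = v + ((1 - d / (d + e)) * d - (d / (d + e)) * e) *\<^sub>R level_dir s"
      by (simp add: algebra_simps)
    ultimately show ?thesis by simp
  qed
  moreover have "?p \<noteq> ?q"
  proof
    assume "?p = ?q"
    then have "(d + e) *\<^sub>R level_dir s = 0" by (simp add: algebra_simps)
    then show False using de by simp
  qed
  ultimately have "v \<in> open_segment ?p ?q"
    unfolding in_segment using de by (intro conjI exI[of _ "d / (d + e)"]) (auto simp: field_simps)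
  then show False using assms(1) de unfolding extreme_point_of_def by blast
qed

lemma enters_extreme_level_False:
  assumes "v \<in> C" "convex hull C = T" "\<sigma> \<in> {1, -1}" "enters s T v \<sigma>"
    and "(\<forall>c\<in>C. c \<noteq> v \<longrightarrow> level s v < level s c) \<or> (\<forall>c\<in>C. c \<noteq> v \<longrightarrow> level s c < level s v)"
  shows False
proof -
  obtain e where e: "e > 0" "v + (e * \<sigma>) *\<^sub>R level_dir s \<in> convex hull C"
    using assms unfolding enters_def by auto
  have "v + (e * \<sigma>) *\<^sub>R level_dir s = v"
    using assms(5) hull_level_min_unique[OF assms(1) _ e(2), of s]
      hull_level_max_unique[OF assms(1) _ e(2), of s] by fastforce
  then show False using e assms(3) by auto
qed

section \<open>The middle vertex of a triangle\<close>

text \<open>The level line of the middle vertex \<open>b\<close> crosses the opposite side at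
  \<open>p\<close>, and affine independence keeps \<open>p\<close> away from \<open>b\<close>. The
  segment from \<open>b\<close> to \<open>p\<close> shows how the triangle is entered from
  \<open>b\<close>.\<close>

lemma triangle_sorted_vertices:
  assumes "2 simplex T" "inj_on (level s) {v. v extreme_point_of T}"
  obtains a b c p where "{v. v extreme_point_of T} = {a, b, c}" "T = convex hull {a, b, c}"
    "level s a < level s b" "level s b < level s c"
    "p \<in> open_segment a c" "level s p = level s b" "p \<noteq> b"
proof -
  obtain V where V: "\<not> affine_dependent V" "int (card V) = 2 + 1" "T = convex hull V"
    using assms(1) unfolding simplex_def by blast
  have ext: "{v. v extreme_point_of T} = V"
    using V extreme_point_of_convex_hull_affine_independent by blast
  have "card V = 3" using V by simp
  then obtain x y z where xyz: "V = {x, y, z}" "x \<noteq> y" "y \<noteq> z" "x \<noteq> z"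
    by (auto simp: card_3_iff)
  note result = that
  have wlog: thesis if abc: "V = {a, b, c}" "level s a < level s b" "level s b < level s c" for a b c
  proof -
    obtain p where p: "p \<in> open_segment a c" "level s p = level s b"
      using level_crossing[OF abc(2,3)] .
    have "p \<noteq> b"
    proof
      assume "p = b"
      then have "b \<in> closed_segment a c" using p by (simp add: open_segment_def)
      then have "collinear {a, b, c}" by (metis between_imp_collinear between_mem_segment)
      then show False using V(1) abc by (auto simp: collinear_3_eq_affine_dependent)
    qed
    then show thesis using result[of a b c p] ext V(3) abc p by simp
  qed
  have "level s x \<noteq> level s y" "level s y \<noteq> level s z" "level s x \<noteq> level s z"
    using assms(2) xyz unfolding ext inj_on_def by auto
  then consider "level s x < level s y" "level s y < level s z" | "level s x < level s z" "level s z < level s y"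
    | "level s y < level s x" "level s x < level s z" | "level s y < level s z" "level s z < level s x"
    | "level s z < level s x" "level s x < level s y" | "level s z < level s y" "level s y < level s x"
    by linarith
  then show thesis
    by cases (use wlog xyz(1) in \<open>blast+\<close>)
qed

text \<open>The direction from the middle vertex towards the opposite side enters \<open>T\<close>.
  The lowest and the highest vertex are alone on their level lines, and an extreme point cannot be
  entered from in both directions.\<close>

lemma triangle_unique_germ:
  assumes "2 simplex T" "inj_on (level s) {v. v extreme_point_of T}"
  shows "\<exists>!p. fst p extreme_point_of T \<and> snd p \<in> {1, -1} \<and> enters s T (fst p) (snd p)"
proof -
  obtain a b c p where abc: "{v. v extreme_point_of T} = {a, b, c}" "T = convex hull {a, b, c}"
    "level s a < level s b" "level s b < level s c"
    and p: "p \<in> open_segment a c" "level s p = level s b" "p \<noteq> b"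
    using triangle_sorted_vertices[OF assms] .
  have T: "a \<in> T" "b \<in> T" "c \<in> T" "convex T" by (auto simp: abc(2) hull_inc)
  have "p \<in> T" using p T convex_contains_open_segment by blast
  then obtain \<sigma> where \<sigma>: "\<sigma> \<in> {1, -1}" "enters s T b \<sigma>"
    using enters_cases p by metis
  show ?thesis
  proof (rule ex1I[of _ "(b, \<sigma>)"])
    show "fst (b, \<sigma>) extreme_point_of T \<and> snd (b, \<sigma>) \<in> {1, -1} \<and> enters s T (fst (b, \<sigma>)) (snd (b, \<sigma>))"
      using \<sigma> abc(1) by auto
  next
    fix q assume q: "fst q extreme_point_of T \<and> snd q \<in> {1, -1} \<and> enters s T (fst q) (snd q)"
    obtain v \<tau> where vt: "q = (v, \<tau>)" by fastforce
    have v: "v \<in> {a, b, c}" "\<tau> \<in> {1, -1}" "enters s T v \<tau>" using q vt abc(1) by auto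
    have "v \<noteq> a" using enters_extreme_level_False[of v "{a,b,c}" T \<tau> s] v abc by auto
    moreover have "v \<noteq> c" using enters_extreme_level_False[of v "{a,b,c}" T \<tau> s] v abc by auto
    ultimately have [simp]: "v = b" using v by simp
    have "b extreme_point_of T" using abc(1) by auto
    then have "\<tau> = \<sigma>" using extreme_point_not_enters_both[of b T s] \<sigma> v by auto
    then show "q = (b, \<sigma>)" using vt by simp
  qed
qed

lemma enters_shorter:
  assumes "convex T" "v \<in> T" "v + (e * \<sigma>) *\<^sub>R w \<in> T" "0 < d" "d \<le> (e :: real)"
  shows "v + (d * \<sigma>) *\<^sub>R w \<in> T"
proof -
  have "(1 - d / e) *\<^sub>R v + (d / e) *\<^sub>R (v + (e * \<sigma>) *\<^sub>R w) \<in> T"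
    using assms by (intro convexD) (auto simp: field_simps)
  moreover have "(1 - d / e) *\<^sub>R v + (d / e) *\<^sub>R (v + (e * \<sigma>) *\<^sub>R w) = v + (d / e * (e * \<sigma>)) *\<^sub>R w"
    by (simp add: algebra_simps)
  moreover have "d / e * (e * \<sigma>) = d * \<sigma>" using assms by simp
  ultimately show ?thesis by simp
qed

text \<open>Just after leaving \<open>v\<close>, the ray runs through the interior of \<open>T\<close>, which no proper face meets.\<close>

lemma face_containing_germ:
  assumes "2 simplex T" "inj_on (level s) {v. v extreme_point_of T}"
    and "v extreme_point_of T" "\<sigma> \<in> {1, -1}" "F face_of T" "v \<in> F" "enters s F v \<sigma>"
  shows "F = T"
proof -
  obtain a b c p where abc: "{v. v extreme_point_of T} = {a, b, c}" "T = convex hull {a, b, c}"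
    "level s a < level s b" "level s b < level s c"
    and p: "p \<in> open_segment a c" "level s p = level s b" "p \<noteq> b"
    using triangle_sorted_vertices[OF assms(1,2)] .
  have T: "a \<in> T" "b \<in> T" "c \<in> T" "convex T" by (auto simp: abc(2) hull_inc)
  have FT: "F \<subseteq> T" "convex F" using assms(5) by (auto simp: face_of_imp_subset face_of_imp_convex)
  have eT: "enters s T v \<sigma>" using assms(7) FT unfolding enters_def by blast
  have v: "v \<in> {a, b, c}" using assms(3) abc(1) by auto
  have "v \<noteq> a" using enters_extreme_level_False[of v "{a,b,c}" T \<sigma> s] v abc assms(4) eT by auto
  moreover have "v \<noteq> c" using enters_extreme_level_False[of v "{a,b,c}" T \<sigma> s] v abc assms(4) eT by auto
  ultimately have [simp]: "v = b" using v by simp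
  have pT: "p \<in> T" using p T convex_contains_open_segment by blast
  \<comment> \<open>The germ must point towards \<open>p\<close>: \<open>T\<close> is entered from
    \<open>b\<close> in direction \<open>sgn t\<close> and in direction \<open>\<sigma>\<close>, and
    these cannot be opposite.\<close>
  define t where "t = p $ 2 - b $ 2"
  have pt: "p = b + t *\<^sub>R level_dir s" using level_eqD[OF p(2)] by (simp add: t_def)
  then have "t \<noteq> 0" using \<open>p \<noteq> b\<close> by auto
  have sg: "sgn t \<in> {1, -1}" using \<open>t \<noteq> 0\<close> by (auto simp: sgn_if)
  have "enters s T b (sgn t)"
    unfolding enters_def using pt pT \<open>t \<noteq> 0\<close> by (intro exI[of _ "\<bar>t\<bar>"]) (auto simp: abs_mult_sgn)
  then have "sgn t = \<sigma>"
    using extreme_point_not_enters_both[of b T s] eT sg assms(3,4) by auto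
  then have tabs: "t = \<bar>t\<bar> * \<sigma>" using abs_mult_sgn[of t] by simp
  obtain e where e: "e > 0" "b + (e * \<sigma>) *\<^sub>R level_dir s \<in> F"
    using assms(7) unfolding enters_def by auto
  \<comment> \<open>The bound \<open>e\<close> keeps \<open>q\<close> in \<open>F\<close>; half of
    \<open>\<bar>t\<bar>\<close> keeps it strictly between \<open>b\<close> and
    \<open>p\<close>.\<close>
  define d where "d = min e (\<bar>t\<bar> / 2)"
  have d: "0 < d" "d \<le> e" "d < \<bar>t\<bar>" using e \<open>t \<noteq> 0\<close> by (auto simp: d_def)
  define q where "q = b + (d * \<sigma>) *\<^sub>R level_dir s"
  have qF: "q \<in> F" unfolding q_def
    by (rule enters_shorter[OF FT(2) _ e(2) d(1,2)]) (use assms(6) in simp)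
  have "q = (1 - d / \<bar>t\<bar>) *\<^sub>R b + (d / \<bar>t\<bar>) *\<^sub>R p"
  proof -
    have "d / \<bar>t\<bar> * t = d * \<sigma>" using tabs \<open>t \<noteq> 0\<close> by (metis abs_eq_0 nonzero_mult_div_cancel_left times_divide_eq_left mult.assoc mult.left_commute)
    then show ?thesis by (simp add: q_def pt algebra_simps)
  qed
  then have "q \<in> open_segment b p"
    using d \<open>p \<noteq> b\<close> unfolding in_segment by (intro conjI exI[of _ "d / \<bar>t\<bar>"]) auto
  \<comment> \<open>The face property is applied twice: \<open>q\<close> inside the segment from
    \<open>b\<close> to \<open>p\<close> pulls \<open>p\<close> into \<open>F\<close>, and
    \<open>p\<close> inside the side from \<open>a\<close> to \<open>c\<close> pulls in the other
    two vertices.\<close>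
  then have "p \<in> F" "b \<in> F" using face_ofD[OF assms(5) _ T(2) pT qF] by auto
  then have "a \<in> F" "c \<in> F" using face_ofD[OF assms(5) p(1) T(1,3)] by auto
  then have "T \<subseteq> F" unfolding abc(2) using \<open>b \<in> F\<close> FT by (intro hull_minimal) auto
  then show ?thesis using FT by simp
qed

section \<open>Triangles of a triangulation correspond to germs\<close>

text \<open>A point of \<open>C\<close> is a vertex of some triangle \<open>T'\<close>, hence of the
  common face of \<open>T\<close> and \<open>T'\<close>, hence of \<open>T\<close>. So no point of
  \<open>C\<close> lies inside an edge of a triangle.\<close>

lemma triangulates_vertex_extreme:
  assumes "triangulates \<T> C" "T \<in> \<T>" "v \<in> C" "v \<in> T"
  shows "v extreme_point_of T"
proof -
  obtain T' where T': "T' \<in> \<T>" "v extreme_point_of T'"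
    using assms unfolding triangulates_def by blast
  have f: "(T \<inter> T') face_of T" "(T' \<inter> T) face_of T'"
    using assms T' unfolding triangulates_def triangulation_def by blast+
  have "v \<in> T' \<inter> T" using assms T' by (auto simp: extreme_point_of_def)
  then have "v extreme_point_of (T' \<inter> T)" using extreme_point_of_face[OF f(2)] T' by simp
  then show ?thesis using extreme_point_of_face[OF f(1)] by (simp add: Int_commute)
qed

definition germs :: "real \<Rightarrow> (real^2) set \<Rightarrow> ((real^2) \<times> real) set" where
  "germs s C = {(v, \<sigma>). v \<in> C \<and> \<sigma> \<in> {1, -1} \<and> enters s (convex hull C) v \<sigma>}"

text \<open>Existence: points of the ray tend to \<open>v\<close>, one of the finitely many
  triangles contains infinitely many of them, and being closed it contains \<open>v\<close>.
  Uniqueness: two such triangles meet in a common face that contains the germ, so this face is all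
  of either triangle.\<close>

lemma germ_unique_triangle:
  assumes tr: "triangulates \<T> C" and inj: "inj_on (level s) C" and g: "(v, \<sigma>) \<in> germs s C"
  shows "\<exists>!T. T \<in> \<T> \<and> v \<in> T \<and> enters s T v \<sigma>"
proof -
  have fin: "finite \<T>" and simp2: "\<And>T. T \<in> \<T> \<Longrightarrow> 2 simplex T" and un: "\<Union>\<T> = convex hull C"
    and face: "\<And>T T'. T \<in> \<T> \<Longrightarrow> T' \<in> \<T> \<Longrightarrow> (T \<inter> T') face_of T"
    and ext: "{v. \<exists>T\<in>\<T>. v extreme_point_of T} = C"
    using tr unfolding triangulates_def triangulation_def by blast+
  have inj': "inj_on (level s) {v. v extreme_point_of T}" if "T \<in> \<T>" for T
    using that ext by (intro inj_on_subset[OF inj]) blast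
  have vC: "v \<in> C" "\<sigma> \<in> {1, -1}" "enters s (convex hull C) v \<sigma>" using g by (auto simp: germs_def)
  have closed: "closed T" "convex T" if "T \<in> \<T>" for T
    using simp2[OF that] by (auto simp: closed_simplex convex_simplex)
  obtain e where e: "e > 0" "v + (e * \<sigma>) *\<^sub>R level_dir s \<in> convex hull C"
    using vC unfolding enters_def by blast
  \<comment> \<open>Dividing by \<open>Suc n\<close> never moves the point beyond \<open>e\<close>,
    so convexity keeps the whole sequence in the hull.\<close>
  define x where "x n = v + (e / Suc n * \<sigma>) *\<^sub>R level_dir s" for n
  have "x n \<in> \<Union>\<T>" for n unfolding un x_def
    by (rule enters_shorter[OF convex_convex_hull _ e(2)])
      (use e vC in \<open>auto simp: hull_inc divide_le_eq mult_le_cancel_left1 mult_left_le\<close>)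
  then have "\<forall>n. \<exists>T. T \<in> \<T> \<and> x n \<in> T" by blast
  then obtain f where f: "\<And>n. f n \<in> \<T>" "\<And>n. x n \<in> f n" by metis
  have "finite (range f)" using fin f by (auto intro: finite_subset)
  then obtain n0 where inf: "infinite {n. f n = f n0}"
    using pigeonhole_infinite[of "UNIV :: nat set" f] infinite_UNIV_nat by auto
  define T where "T = f n0"
  have T: "T \<in> \<T>" using f by (simp add: T_def)
  have xlim: "x \<longlonglongrightarrow> v"
  proof -
    have "(\<lambda>n. e / Suc n) \<longlonglongrightarrow> 0"
      by (rule LIMSEQ_Suc[OF lim_const_over_n])
    then have "(\<lambda>n. v + (e / Suc n * \<sigma>) *\<^sub>R level_dir s) \<longlonglongrightarrow> v + (0 * \<sigma>) *\<^sub>R level_dir s"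
      by (intro tendsto_intros)
    then show ?thesis by (simp add: x_def[abs_def])
  qed
  obtain r :: "nat \<Rightarrow> nat" where r: "strict_mono r" "\<And>n. r n \<in> {n. f n = f n0}"
    using infinite_enumerate[OF inf] by blast
  have "(x \<circ> r) n \<in> T" for n using r(2)[of n] f(2)[of "r n"] by (simp add: T_def)
  then have "v \<in> T"
    using closed_sequentially[OF closed(1)[OF T] _ LIMSEQ_subseq_LIMSEQ[OF xlim r(1)]] by blast
  moreover have "enters s T v \<sigma>"
    unfolding enters_def using f(2)[of n0] e by (intro exI[of _ "e / Suc n0"]) (auto simp: x_def T_def)
  moreover have "T1 = T2"
    if T12: "T1 \<in> \<T>" "v \<in> T1" "enters s T1 v \<sigma>" "T2 \<in> \<T>" "v \<in> T2" "enters s T2 v \<sigma>" for T1 T2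
  proof -
    obtain e1 e2 where e12: "e1 > 0" "e2 > 0" "v + (e1 * \<sigma>) *\<^sub>R level_dir s \<in> T1"
      "v + (e2 * \<sigma>) *\<^sub>R level_dir s \<in> T2"
      using T12 unfolding enters_def by blast
    have "v + (min e1 e2 * \<sigma>) *\<^sub>R level_dir s \<in> T1" "v + (min e1 e2 * \<sigma>) *\<^sub>R level_dir s \<in> T2"
      using T12 e12 closed by (auto intro!: enters_shorter[of T1 v e1] enters_shorter[of T2 v e2])
    then have en: "enters s (T1 \<inter> T2) v \<sigma>"
      unfolding enters_def using e12 by (intro exI[of _ "min e1 e2"]) auto
    have "T1 \<inter> T2 = T1"
      using T12 en vC tr by (intro face_containing_germ[of T1 s v \<sigma>] simp2 inj' face)
        (auto intro: triangulates_vertex_extreme)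
    moreover have "T2 \<inter> T1 = T2"
      using T12 en vC tr by (intro face_containing_germ[of T2 s v \<sigma>] simp2 inj' face)
        (auto intro: triangulates_vertex_extreme simp: Int_commute)
    ultimately show ?thesis by blast
  qed
  ultimately show ?thesis using T by blast
qed

text \<open>Assigning to a triangle the germ at its middle vertex is a bijection, because each side
  determines the other uniquely.\<close>

lemma card_triangulation_eq_card_germs:
  assumes tr: "triangulates \<T> C" and inj: "inj_on (level s) C"
  shows "card \<T> = card (germs s C)"
proof -
  define R where "R T p \<longleftrightarrow> fst p \<in> T \<and> enters s T (fst p) (snd p)" for T and p :: "(real^2) \<times> real"
  have simp2: "\<And>T. T \<in> \<T> \<Longrightarrow> 2 simplex T" and un: "\<Union>\<T> = convex hull C"
    and ext: "{v. \<exists>T\<in>\<T>. v extreme_point_of T} = C"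
    using tr unfolding triangulates_def by blast+
  have ex1T: "\<exists>!p. p \<in> germs s C \<and> R T p" if T: "T \<in> \<T>" for T
  proof -
    have "inj_on (level s) {v. v extreme_point_of T}"
      using T ext by (intro inj_on_subset[OF inj]) blast
    note ex1 = triangle_unique_germ[OF simp2[OF T] this]
    \<comment> \<open>The points of \<open>C\<close> in \<open>T\<close> are exactly the vertices of
      \<open>T\<close>, so incidence with a germ of \<open>C\<close> is the condition known to have
      a unique solution.\<close>
    have "p \<in> germs s C \<and> R T p \<longleftrightarrow>
        fst p extreme_point_of T \<and> snd p \<in> {1, -1} \<and> enters s T (fst p) (snd p)" for p
    proof
      assume "p \<in> germs s C \<and> R T p"
      then show "fst p extreme_point_of T \<and> snd p \<in> {1, -1} \<and> enters s T (fst p) (snd p)"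
        using triangulates_vertex_extreme[OF tr T] by (auto simp: germs_def R_def)
    next
      assume p: "fst p extreme_point_of T \<and> snd p \<in> {1, -1} \<and> enters s T (fst p) (snd p)"
      then have "fst p \<in> C" using ext T by blast
      moreover have "enters s (convex hull C) (fst p) (snd p)"
        using p un T unfolding enters_def by blast
      ultimately show "p \<in> germs s C \<and> R T p"
        using p by (auto simp: germs_def R_def extreme_point_of_def case_prod_beta)
    qed
    then show ?thesis using ex1 by simp
  qed
  have ex1p: "\<exists>!T. T \<in> \<T> \<and> R T p" if "p \<in> germs s C" for p
    using germ_unique_triangle[OF tr inj, of "fst p" "snd p"] that by (simp add: R_def)
  define h where "h T = (THE p. p \<in> germs s C \<and> R T p)" for T
  have h: "h T \<in> germs s C \<and> R T (h T)" if "T \<in> \<T>" for T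
    unfolding h_def by (rule theI'[OF ex1T[OF that]])
  have "bij_betw h \<T> (germs s C)"
  proof (rule bij_betw_imageI)
    show "inj_on h \<T>" using h ex1p by (intro inj_onI) metis
    show "h ` \<T> = germs s C"
    proof (intro equalityI subsetI)
      fix p assume p: "p \<in> germs s C"
      then obtain T where "T \<in> \<T>" "R T p" using ex1p by blast
      then have "h T = p" using h ex1T p by metis
      then show "p \<in> h ` \<T>" using \<open>T \<in> \<T>\<close> by blast
    qed (use h in blast)
  qed
  then show ?thesis by (rule bij_betw_same_card)
qed

section \<open>Counting germs at interior and boundary points\<close>

lemma enters_interior:
  assumes "v \<in> interior S"
  shows "enters s S v \<sigma>"
proof -
  have "((\<lambda>e. v + (e * \<sigma>) *\<^sub>R level_dir s) \<longlongrightarrow> v + (0 * \<sigma>) *\<^sub>R level_dir s) (at_right 0)"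
    by (intro tendsto_intros)
  then have "\<forall>\<^sub>F e in at_right 0. v + (e * \<sigma>) *\<^sub>R level_dir s \<in> interior S"
    using assms by (intro topological_tendstoD) auto
  moreover have "\<forall>\<^sub>F e::real in at_right 0. e > 0" by (rule eventually_at_right_less)
  ultimately have "\<forall>\<^sub>F e in at_right 0. e > 0 \<and> v + (e * \<sigma>) *\<^sub>R level_dir s \<in> S"
    by eventually_elim (use interior_subset in auto)
  then show ?thesis
    unfolding enters_def using eventually_happens' trivial_limit_at_right_real by blast
qed

text \<open>A supporting functional at a boundary point entered from on both sides would be constant
  on the level line, hence a multiple of \<open>level s\<close>. But \<open>C\<close> has points
  strictly below and strictly above \<open>v\<close>.\<close>

lemma enters_both_imp_interior:
  fixes C :: "(real^2) set"
  assumes "\<not> collinear C" "v \<in> convex hull C"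
    and "enters s (convex hull C) v 1" "enters s (convex hull C) v (-1)"
    and "x \<in> C" "level s x < level s v" "y \<in> C" "level s v < level s y"
  shows "v \<in> interior (convex hull C)"
proof (rule ccontr)
  assume "v \<notin> interior (convex hull C)"
  \<comment> \<open>The hull is full-dimensional, so a point outside its interior is outside its
    relative interior and admits a supporting hyperplane.\<close>
  moreover have "aff_dim C = 2"
    using assms(1) aff_dim_le_DIM[of C] by (simp add: collinear_aff_dim)
  then have "affine hull (convex hull C) = UNIV"
    using aff_dim_eq_full[of "convex hull C"] by (simp add: aff_dim_convex_hull)
  ultimately have "v \<notin> rel_interior (convex hull C)" by (simp add: rel_interior_interior)
  then obtain g where g: "g \<noteq> 0" "\<And>y. y \<in> convex hull C \<Longrightarrow> g \<bullet> v \<le> g \<bullet> y"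
    using supporting_hyperplane_rel_boundary[OF convex_convex_hull assms(2)] by metis
  obtain d e where de: "d > 0" "e > 0" "v + d *\<^sub>R level_dir s \<in> convex hull C"
      "v - e *\<^sub>R level_dir s \<in> convex hull C"
    using assms(3,4) unfolding enters_def by auto
  have "0 \<le> d * (g \<bullet> level_dir s)" "0 \<le> - (e * (g \<bullet> level_dir s))"
    using g(2)[OF de(3)] g(2)[OF de(4)] by (auto simp: inner_simps)
  then have "g \<bullet> level_dir s = 0"
    using de by (auto simp: zero_le_mult_iff mult_le_0_iff)
  then have g2: "g $ 2 = s * g $ 1" by (simp add: inner_vec_def sum_2 level_dir_def)
  have gl: "g \<bullet> z = g $ 1 * level s z" for z
    by (simp add: inner_vec_def sum_2 level_def g2 algebra_simps)
  have "g $ 1 \<noteq> 0" using g(1) g2 by (auto simp: vec_eq_iff forall_2)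
  moreover have "g $ 1 * level s v \<le> g $ 1 * level s x" "g $ 1 * level s v \<le> g $ 1 * level s y"
    using g(2)[of x] g(2)[of y] assms by (auto simp: gl hull_inc)
  ultimately show False using assms(6,8) by (auto simp: mult_le_cancel_left)
qed

text \<open>If the hull met the level line of \<open>v\<close> only in \<open>v\<close>, every
  segment from a point of \<open>C\<close> below to one above would pass through \<open>v\<close>.
  All of \<open>C\<close> would then lie on the line through \<open>x\<close> and
  \<open>v\<close>.\<close>

lemma enters_some:
  fixes C :: "(real^2) set"
  assumes nc: "\<not> collinear C" and inj: "inj_on (level s) C" and v: "v \<in> C"
    and x: "x \<in> C" "level s x < level s v" and y: "y \<in> C" "level s v < level s y"
  obtains \<sigma> where "\<sigma> \<in> {1, -1}" "enters s (convex hull C) v \<sigma>"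
proof (rule ccontr)
  assume notthesis: "\<not> thesis"
  note prem = that notthesis
  have single: "p = v" if "p \<in> convex hull C" "level s p = level s v" for p
    using enters_cases[OF that, of thesis] prem by blast
  have seg: "v \<in> open_segment a c"
    if ac: "a \<in> C" "c \<in> C" "level s a < level s v" "level s v < level s c" for a c
  proof -
    obtain p where p: "p \<in> open_segment a c" "level s p = level s v"
      using level_crossing[OF ac(3,4)] .
    have "p \<in> convex hull C"
      using p ac convex_contains_open_segment[of "convex hull C"] by (meson convex_convex_hull hull_inc subsetD)
    then show ?thesis using p single by metis
  qed
  have line: "\<exists>k. c = v + k *\<^sub>R (a - v)" if ac: "v \<in> open_segment a c" for a c
  proof -
    obtain u where u: "0 < u" "u < 1" "v = (1 - u) *\<^sub>R a + u *\<^sub>R c"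
      using ac unfolding in_segment by blast
    have "u *\<^sub>R (c - v) - (u - 1) *\<^sub>R (a - v) = ((1 - u) *\<^sub>R a + u *\<^sub>R c) - v"
      by (simp add: algebra_simps)
    then have "u *\<^sub>R (c - v) = (u - 1) *\<^sub>R (a - v)" using u(3) by simp
    then have "(1 / u) *\<^sub>R u *\<^sub>R (c - v) = (1 / u) *\<^sub>R (u - 1) *\<^sub>R (a - v)" by simp
    then have "c - v = ((u - 1) / u) *\<^sub>R (a - v)" using u(1) by simp
    then have "c = v + ((u - 1) / u) *\<^sub>R (a - v)" by (simp add: algebra_simps)
    then show ?thesis by blast
  qed
  have up: "\<exists>k. c = v + k *\<^sub>R (x - v)" if "c \<in> C" "level s v < level s c" for c
    using line seg x that by blast
  have "\<exists>k. c = v + k *\<^sub>R (x - v)" if c: "c \<in> C" for c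
  proof (cases "level s c" "level s v" rule: linorder_cases)
    case less
    \<comment> \<open>A point below is linked to \<open>y\<close> by a segment through
      \<open>v\<close>, and \<open>y\<close> is already known to lie on the line.\<close>
    obtain k where k: "y = v + k *\<^sub>R (x - v)" using up y by blast
    obtain k' where "c = v + k' *\<^sub>R (y - v)"
      using line[of y c] seg[OF c y(1) less y(2)] by (auto simp: open_segment_commute)
    then have "c = v + (k' * k) *\<^sub>R (x - v)" using k by simp
    then show ?thesis by blast
  next
    case equal
    then have "c = v + 0 *\<^sub>R (x - v)" using inj c v by (simp add: inj_on_def)
    then show ?thesis by blast
  next
    case greater
    then show ?thesis using up c by blast
  qed
  then have "collinear C" unfolding collinear_alt by blast
  with nc show False by simp
qed

lemma frontier_hull_iff:
  fixes C :: "(real^2) set"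
  assumes "finite C" "v \<in> C"
  shows "v \<in> frontier (convex hull C) \<longleftrightarrow> v \<notin> interior (convex hull C)"
  using assms by (simp add: frontier_def closure_closed compact_imp_closed finite_imp_compact_convex_hull hull_inc)

lemma interior_plus_boundary_count:
  assumes "finite C"
  shows "interior_count C + boundary_count C = card C"
proof -
  have "C = (C \<inter> interior (convex hull C)) \<union> (C \<inter> frontier (convex hull C))"
    using frontier_hull_iff[OF assms] by auto
  moreover have "(C \<inter> interior (convex hull C)) \<inter> (C \<inter> frontier (convex hull C)) = {}"
    by (auto simp: frontier_def)
  ultimately show ?thesis
    unfolding interior_count_def boundary_count_def using assms
    by (metis card_Un_disjoint finite_Int)
qed

text \<open>The minimum and the maximum are two distinct boundary points without germs. Adding 2 on
  the left avoids truncated subtraction.\<close>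

lemma boundary_count_ge_2_and_card_germs:
  assumes fin: "finite C" and nc: "\<not> collinear C" and inj: "inj_on (level s) C"
  shows "2 \<le> boundary_count C" "card (germs s C) + 2 = 2 * interior_count C + boundary_count C"
proof -
  let ?H = "convex hull C"
  have "C \<noteq> {}" using nc by auto
  obtain a where a: "a \<in> C" "\<And>x. x \<in> C \<Longrightarrow> level s a \<le> level s x"
    using arg_min_if_finite(1)[OF fin \<open>C \<noteq> {}\<close>] arg_min_least[OF fin \<open>C \<noteq> {}\<close>] by blast
  obtain z where z: "z \<in> C" "\<And>x. x \<in> C \<Longrightarrow> level s x \<le> level s z"
    using arg_min_if_finite(1)[OF fin \<open>C \<noteq> {}\<close>, of "\<lambda>x. - level s x"]
      arg_min_least[OF fin \<open>C \<noteq> {}\<close>, of _ "\<lambda>x. - level s x"] by (meson neg_le_iff_le)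
  have a': "level s a < level s x" if "x \<in> C" "x \<noteq> a" for x
    using a that inj unfolding inj_on_def by (metis order_le_less)
  have z': "level s x < level s z" if "x \<in> C" "x \<noteq> z" for x
    using z that inj unfolding inj_on_def by (metis order_le_less)
  have "a \<noteq> z"
  proof
    assume "a = z"
    then have "x = a" if "x \<in> C" for x using a'[OF that] z'[OF that] by force
    then have "C \<subseteq> {a}" by blast
    then show False using nc collinear_subset[of "{a}" C] by simp
  qed
  define N where "N v = {\<sigma> \<in> {1, -1}. enters s ?H v \<sigma>}" for v
  have Na: "N a = {}" "N z = {}"
    using enters_extreme_level_False[OF a(1) refl] enters_extreme_level_False[OF z(1) refl] a' z'
    unfolding N_def by blast+
  have Nint: "N v = {1, -1}" if "v \<in> interior ?H" for v
    using enters_interior[OF that] by (auto simp: N_def)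
  have Nfr: "card (N v) = 1" if v: "v \<in> C" "v \<notin> interior ?H" "v \<noteq> a" "v \<noteq> z" for v
  proof -
    obtain \<sigma> where \<sigma>: "\<sigma> \<in> {1, -1}" "enters s ?H v \<sigma>"
      using enters_some[OF nc inj v(1) a(1) a'[OF v(1,3)] z(1) z'[OF v(1,4)]] .
    have "\<not> (enters s ?H v 1 \<and> enters s ?H v (-1))"
      using enters_both_imp_interior[OF nc hull_inc[OF v(1)] _ _ a(1) a'[OF v(1,3)] z(1) z'[OF v(1,4)]] v(2)
      by blast
    then have "N v = {\<sigma>}" using \<sigma> by (auto simp: N_def)
    then show ?thesis by simp
  qed
  define I where "I = C \<inter> interior ?H"
  define F where "F = C \<inter> frontier ?H"
  have IF: "C = I \<union> F" "I \<inter> F = {}" "finite I" "finite F"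
    using frontier_hull_iff[OF fin] fin by (auto simp: I_def F_def)
  \<comment> \<open>Interior points have two germs, whereas \<open>a\<close> and \<open>z\<close>
    have none.\<close>
  have "a \<notin> interior ?H" "z \<notin> interior ?H" using Nint Na by auto
  then have az: "{a, z} \<subseteq> F" using a z frontier_hull_iff[OF fin] by (auto simp: F_def)
  then have "card {a, z} \<le> card F" using IF by (intro card_mono) auto
  then have F2: "2 \<le> card F" using \<open>a \<noteq> z\<close> by simp
  then show "2 \<le> boundary_count C" by (simp add: boundary_count_def F_def)
  have "germs s C = Sigma C N" by (auto simp: germs_def N_def)
  then have "card (germs s C) = (\<Sum>v\<in>C. card (N v))"
    using fin by (simp add: N_def)
  also have "\<dots> = (\<Sum>v\<in>I. card (N v)) + (\<Sum>v\<in>F. card (N v))"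
    using IF by (metis sum.union_disjoint)
  also have "(\<Sum>v\<in>I. card (N v)) = (\<Sum>v\<in>I. 2)"
    by (rule sum.cong) (auto simp: Nint I_def)
  also have "(\<Sum>v\<in>F. card (N v)) = (\<Sum>v\<in>F - {a, z}. card (N v)) + (\<Sum>v\<in>{a, z}. card (N v))"
    using IF az by (metis sum.subset_diff)
  also have "(\<Sum>v\<in>{a, z}. card (N v)) = 0" using Na by (auto intro!: sum.neutral)
  also have "(\<Sum>v\<in>F - {a, z}. card (N v)) = (\<Sum>v\<in>F - {a, z}. 1)"
    using Nfr frontier_hull_iff[OF fin] by (intro sum.cong) (auto simp: F_def)
  \<comment> \<open>This subtraction of naturals is not truncated, by \<open>F2\<close>.\<close>
  also have "\<dots> = card F - 2" using az IF \<open>a \<noteq> z\<close> by (simp add: card_Diff_subset)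
  finally show "card (germs s C) + 2 = 2 * interior_count C + boundary_count C"
    using F2 by (simp add: interior_count_def boundary_count_def I_def F_def)
qed

lemma boundary_count_ge_2:
  assumes "finite C" "\<not> collinear C"
  shows "2 \<le> boundary_count C"
  using exists_injective_level[OF assms(1)] boundary_count_ge_2_and_card_germs(1)[OF assms] by metis

theorem card_triangulation:
  assumes "finite C" "\<not> collinear C" "triangulates \<T> C"
  shows "card \<T> + 2 = 2 * interior_count C + boundary_count C"
  using exists_injective_level[OF assms(1)] boundary_count_ge_2_and_card_germs(2)[OF assms(1,2)]
    card_triangulation_eq_card_germs[OF assms(3)] by metis

section \<open>The boundary of a Minkowski sum\<close>

text \<open>The hull of \<open>A\<close> translated by \<open>b\<close> lies in the hull of the sum,
  so an interior \<open>a\<close> would make \<open>a + b\<close> interior.\<close>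

lemma frontier_set_plus:
  fixes A B :: "(real^2) set"
  assumes "finite A" "a \<in> A" "b \<in> B" "a + b \<in> frontier (convex hull (A + B))"
  shows "a \<in> frontier (convex hull A)"
proof (rule ccontr)
  assume "a \<notin> frontier (convex hull A)"
  then have "a \<in> interior (convex hull A)" using frontier_hull_iff[OF assms(1,2)] by simp
  then have "b + a \<in> interior ((+) b ` (convex hull A))" by (simp add: interior_translation)
  moreover have "(+) b ` (convex hull A) \<subseteq> convex hull (A + B)"
    unfolding convex_hull_set_plus using hull_inc[OF assms(3), of convex]
    by (auto simp: add.commute[of b] intro: set_plus_intro)
  ultimately have "a + b \<in> interior (convex hull (A + B))"
    using interior_mono by (metis add.commute subsetD)
  then show False using assms(4) by (simp add: frontier_def)
qed

text \<open>Every boundary point of the sum is a sum of boundary points. Distinct pairs may share a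
  sum, which does no harm to an upper bound.\<close>

lemma boundary_count_set_plus:
  assumes "finite A" "finite B"
  shows "boundary_count (A + B) \<le> boundary_count A * boundary_count B"
proof -
  let ?F = "\<lambda>C. C \<inter> frontier (convex hull C)"
  have "?F (A + B) \<subseteq> ?F A + ?F B"
  proof
    fix x assume x: "x \<in> ?F (A + B)"
    then obtain a b where ab: "a \<in> A" "b \<in> B" "x = a + b" by (auto simp: set_plus_def)
    have "a \<in> ?F A" using frontier_set_plus[OF assms(1) ab(1,2)] x ab by simp
    moreover have "b \<in> ?F B"
      using frontier_set_plus[OF assms(2) ab(2,1)] x ab by (simp add: add.commute)
    ultimately show "x \<in> ?F A + ?F B" using ab by (auto simp: set_plus_def)
  qed
  then have "card (?F (A + B)) \<le> card (?F A + ?F B)"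
    using assms by (intro card_mono finite_set_plus) auto
  also have "?F A + ?F B = (\<lambda>(a, b). a + b) ` (?F A \<times> ?F B)" by (auto simp: set_plus_def)
  also have "card \<dots> \<le> card (?F A \<times> ?F B)" using assms by (intro card_image_le) auto
  finally show ?thesis by (simp add: boundary_count_def card_cartesian_product)
qed

section \<open>The inequality\<close>

lemma sqrt_add_le:
  assumes "0 \<le> x" "0 \<le> y" "2 * (x + y) \<le> z"
  shows "sqrt x + sqrt y \<le> sqrt z"
proof (rule real_le_rsqrt)
  have "0 \<le> (sqrt x - sqrt y)\<^sup>2" by simp
  then show "(sqrt x + sqrt y)\<^sup>2 \<le> z"
    using assms by (simp add: power2_eq_square algebra_simps)
qed

theorem theorem3p1:
  fixes A B :: "(real^2) set"
  assumes "finite A" and "\<not> collinear A"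
    and "finite B" and "\<not> collinear B"
    and "\<And>a1 a2 b1 b2. a1 \<in> A \<Longrightarrow> a2 \<in> A \<Longrightarrow> b1 \<in> B \<Longrightarrow> b2 \<in> B \<Longrightarrow>
           a1 + b1 = a2 + b2 \<Longrightarrow> a1 = a2 \<and> b1 = b2"
  shows "(sqrt (2 * real (interior_count (A + B)) + real (boundary_count (A + B)) - 2)
           \<ge> sqrt (2 * real (interior_count A) + real (boundary_count A) - 2)
             + sqrt (2 * real (interior_count B) + real (boundary_count B) - 2)) \<and>
         (\<forall>\<T> \<T>\<^sub>A \<T>\<^sub>B. triangulates \<T> (A + B) \<and> triangulates \<T>\<^sub>A A \<and> triangulates \<T>\<^sub>B B \<longrightarrow>
           sqrt (real (card \<T>)) \<ge> sqrt (real (card \<T>\<^sub>A)) + sqrt (real (card \<T>\<^sub>B)))"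
proof -
  let ?i = "\<lambda>C. real (interior_count C)" and ?b = "\<lambda>C. real (boundary_count C)"
  have fin: "finite (A + B)" using assms by (simp add: finite_set_plus)
  have nc: "\<not> collinear (A + B)"
  proof
    assume "collinear (A + B)"
    moreover obtain b where "b \<in> B" using assms(4) by fastforce
    \<comment> \<open>The sum contains a translate of \<open>A\<close>, which is
      non-collinear.\<close>
    then have "(+) b ` A \<subseteq> A + B" by (auto simp: set_plus_def add.commute)
    ultimately have "collinear ((+) b ` A)" by (rule collinear_subset)
    then show False using assms(2) by (simp add: collinear_aff_dim aff_dim_translation_eq)
  qed
  \<comment> \<open>Unique representation says that addition is injective on the pairs, so the
    cardinalities multiply.\<close>
  have "A + B = (\<lambda>(a, b). a + b) ` (A \<times> B)" by (auto simp: set_plus_def)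
  moreover have "inj_on (\<lambda>(a, b). a + b) (A \<times> B)" using assms(5) by (auto simp: inj_on_def)
  ultimately have "card (A + B) = card A * card B"
    by (simp add: card_image card_cartesian_product)
  then have "?i (A + B) + ?b (A + B) = (?i A + ?b A) * (?i B + ?b B)"
    using assms fin by (metis interior_plus_boundary_count of_nat_add of_nat_mult)
  moreover have "?b (A + B) \<le> ?b A * ?b B"
    using boundary_count_set_plus[OF assms(1,3)] by (metis of_nat_le_iff of_nat_mult)
  moreover have b: "2 \<le> ?b A" "2 \<le> ?b B"
    using boundary_count_ge_2 assms by (metis of_nat_le_iff of_nat_numeral)+
  \<comment> \<open>After expanding the product and inserting the bound on
    \<open>?b (A + B)\<close>, the two sides of \<open>le\<close> differ by at least the first of
    these terms, plus twice each of the other three, plus 2.\<close>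
  moreover have "0 \<le> (?b A - 2) * (?b B - 2)" "0 \<le> ?i A * (?b B - 2)" "0 \<le> ?i B * (?b A - 2)"
    "0 \<le> ?i A * ?i B"
    using b by simp_all
  ultimately have le: "2 * ((2 * ?i A + ?b A - 2) + (2 * ?i B + ?b B - 2))
      \<le> 2 * ?i (A + B) + ?b (A + B) - 2"
    by (simp only: algebra_simps)
  have sq: "sqrt (2 * ?i A + ?b A - 2) + sqrt (2 * ?i B + ?b B - 2)
      \<le> sqrt (2 * ?i (A + B) + ?b (A + B) - 2)"
    by (rule sqrt_add_le[OF _ _ le]) (use b in simp_all)
  have "real (card \<T>) = 2 * ?i C + ?b C - 2"
    if "finite C" "\<not> collinear C" "triangulates \<T> C" for \<T> C
    using card_triangulation[OF that] by linarith
  with sq show ?thesis using assms fin nc by simp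
qed

end
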